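(* Let $G$ be a connected graph on the vertex set $\{0,1,\ldots,n\}$, and let $P_0$ be the poset of acyclic orientations of $G$ having the vertex $0$ as a sink, ordered by vertex firing. Then each connected component of the poset $P_0$ is a distributive lattice (with respect to the order of $P_0$).
   Context: A vertex is a source of an orientation if all edges incident to it are directed away from it, and a sink if all edges incident to it are directed towards it. If $\Omega$ is an acyclic orientation of $G$ in which the vertex $i$ is a source, then firing $i$ produces the acyclic orientation obtained from $\Omega$ by reorienting all edges incident to $i$ towards $i$ (so that $i$ becomes a sink) and leaving all other edges unchanged. $P_0$ is the set of acyclic orientations of $G$ in which $0$ is a sink (other vertices may also be sinks). For $\Omega,\Omega'\in P_0$, write $\Omega\le\Omega'$ if and only if there is a finite (possibly trivial) sequence $\Omega=\Omega_1,\ldots,\Omega_{m+1}=\Omega'$ of orientations in $P_0$ such that each $\Omega_{t+1}$ is obtained from $\Omega_t$ by firing some vertex. This relation is a partial order on $P_0$. A connected component of a finite poset is a connected component of its comparability graph (the graph on the elements in which two elements are adjacent when they are comparable), with the induced order. *)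

theory Defs
  imports "HOL-Algebra.Lattice" "Graph_Theory.Graph_Theory"
begin

text \<open>
  A finite simple undirected graph is a \<^locale>\<open>pair_graph\<close>: finitely many vertices, no loops,
  and an edge between \<open>u\<close> and \<open>v\<close> is represented by the two arcs \<open>(u, v)\<close> and \<open>(v, u)\<close>.
  An orientation is a set of arcs containing exactly one of the two arcs of every edge.
\<close>

definition orientation :: "'v pair_pre_digraph \<Rightarrow> 'v rel \<Rightarrow> bool" where
  "orientation G \<Omega> \<longleftrightarrow>
     \<Omega> \<subseteq> parcs G \<and> (\<forall>(u, v) \<in> parcs G. (u, v) \<in> \<Omega> \<longleftrightarrow> (v, u) \<notin> \<Omega>)"

definition source :: "'v pair_pre_digraph \<Rightarrow> 'v rel \<Rightarrow> 'v \<Rightarrow> bool" where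
  "source G \<Omega> i \<longleftrightarrow> i \<in> pverts G \<and> (\<forall>v. (i, v) \<in> parcs G \<longrightarrow> (i, v) \<in> \<Omega>)"

definition sink :: "'v pair_pre_digraph \<Rightarrow> 'v rel \<Rightarrow> 'v \<Rightarrow> bool" where
  "sink G \<Omega> i \<longleftrightarrow> i \<in> pverts G \<and> (\<forall>v. (v, i) \<in> parcs G \<longrightarrow> (v, i) \<in> \<Omega>)"

definition fire :: "'v pair_pre_digraph \<Rightarrow> 'v \<Rightarrow> 'v rel \<Rightarrow> 'v rel" where
  "fire G i \<Omega> = {(u, v) \<in> \<Omega>. u \<noteq> i \<and> v \<noteq> i} \<union> {(u, i) | u. (u, i) \<in> parcs G}"

definition sink_orientations :: "'v pair_pre_digraph \<Rightarrow> 'v \<Rightarrow> 'v rel set" where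
  "sink_orientations G s = {\<Omega>. orientation G \<Omega> \<and> acyclic \<Omega> \<and> sink G \<Omega> s}"

definition firing_step :: "'v pair_pre_digraph \<Rightarrow> 'v \<Rightarrow> 'v rel rel" where
  "firing_step G s = {(\<Omega>, \<Omega>'). \<Omega> \<in> sink_orientations G s \<and> \<Omega>' \<in> sink_orientations G s \<and>
     (\<exists>i. source G \<Omega> i \<and> \<Omega>' = fire G i \<Omega>)}"

definition firing_poset :: "'v pair_pre_digraph \<Rightarrow> 'v \<Rightarrow> 'v rel gorder" where
  "firing_poset G s =
     \<lparr>carrier = sink_orientations G s, eq = (=), le = (\<lambda>\<Omega> \<Omega>'. (\<Omega>, \<Omega>') \<in> (firing_step G s)\<^sup>*)\<rparr>"

definition comparability_graph :: "'a gorder \<Rightarrow> 'a pair_pre_digraph" where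
  "comparability_graph L =
     \<lparr>pverts = carrier L,
      parcs = {(x, y). x \<in> carrier L \<and> y \<in> carrier L \<and> x \<noteq> y \<and> (x \<sqsubseteq>\<^bsub>L\<^esub> y \<or> y \<sqsubseteq>\<^bsub>L\<^esub> x)}\<rparr>"

text \<open>
  The comparability graph is symmetric, so that its strongly connected components are its
  connected components.
\<close>

definition order_components :: "'a gorder \<Rightarrow> 'a gorder set" where
  "order_components L =
     {L\<lparr>carrier := C\<rparr> | C. C \<in> pre_digraph.sccs_verts (with_proj (comparability_graph L))}"

locale distributive_lattice = Lattice.lattice L for L (structure) +
  assumes meet_join_distrib:
    "\<lbrakk>x \<in> carrier L; y \<in> carrier L; z \<in> carrier L\<rbrakk>
      \<Longrightarrow> x \<sqinter> (y \<squnion> z) = (x \<sqinter> y) \<squnion> (x \<sqinter> z)"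

end

theory Submission
  imports Defs
begin

text \<open>
  Fix an orientation \<open>\<Omega>\<close> in the component and record every other member by its height function,
  the signed number of times each vertex has been fired starting from \<open>\<Omega>\<close>. The ends of an edge
  fire alternately, so for an arc \<open>(u, v)\<close> of \<open>\<Omega>\<close> the difference \<open>f u - f v\<close> is \<open>0\<close> (arc unchanged)
  or \<open>1\<close> (arc reversed), and \<open>f\<close> vanishes at the sink and its neighbours. Conversely every \<open>f\<close>
  with these properties comes from a member of the component: if \<open>f \<le> g\<close> and \<open>f \<noteq> g\<close>, a vertex
  that is minimal, in the acyclic orientation given by \<open>f\<close>, among those with \<open>f v < g v\<close> is a source
  and can be fired without overshooting \<open>g\<close>. The component is thus isomorphic to a set of integer
  functions with the pointwise order, closed under pointwise minimum and maximum.
\<close>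

section \<open>Transport of distributive lattices along an order embedding\<close>

lemma distributive_lattice_image:
  fixes L :: "'a gorder" and H :: "'b::distrib_lattice set"
  assumes eq: "eq L = (=)"
    and carrier: "carrier L = \<phi> ` H"
    and le_iff: "\<And>x y. x \<in> H \<Longrightarrow> y \<in> H \<Longrightarrow> \<phi> x \<sqsubseteq>\<^bsub>L\<^esub> \<phi> y \<longleftrightarrow> x \<le> y"
    and inf_closed: "\<And>x y. x \<in> H \<Longrightarrow> y \<in> H \<Longrightarrow> Lattices.inf x y \<in> H"
    and sup_closed: "\<And>x y. x \<in> H \<Longrightarrow> y \<in> H \<Longrightarrow> Lattices.sup x y \<in> H"
  shows "distributive_lattice L"
proof -
  have lub: "is_lub L (\<phi> (Lattices.sup x y)) {\<phi> x, \<phi> y}" if "x \<in> H" "y \<in> H" for x y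
    using that by (auto simp: least_def Upper_def carrier le_iff sup_closed)
  have glb: "is_glb L (\<phi> (Lattices.inf x y)) {\<phi> x, \<phi> y}" if "x \<in> H" "y \<in> H" for x y
    using that by (auto simp: greatest_def Lower_def carrier le_iff inf_closed)
  interpret partial_order L
    \<comment> \<open>By \<open>le_iff\<close>, elements of \<open>L\<close> below each other come
      from equal elements of \<open>H\<close>, so antisymmetry is inherited from
      \<open>'b\<close>.\<close>
    by unfold_locales (auto simp: eq carrier le_iff dest: antisym)
  interpret Lattice.lattice L
  proof unfold_locales
    fix x y assume "x \<in> carrier L" "y \<in> carrier L"
    then show "\<exists>z. is_lub L z {x, y}" "\<exists>z. is_glb L z {x, y}"
      using lub glb unfolding carrier by blast+
  qed
  \<comment> \<open>Bounds are unique, so the chosen join and meet of \<open>L\<close> are the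
    images of \<open>sup\<close> and \<open>inf\<close>. Distributivity is then the law
    \<open>inf_sup_distrib1\<close> in \<open>'b\<close>.\<close>
  have join: "\<phi> x \<squnion>\<^bsub>L\<^esub> \<phi> y = \<phi> (Lattices.sup x y)" if "x \<in> H" "y \<in> H" for x y
  proof (rule joinI)
    show "l = \<phi> (Lattices.sup x y)" if "is_lub L l {\<phi> x, \<phi> y}" for l
      using that lub[OF \<open>x \<in> H\<close> \<open>y \<in> H\<close>] by (rule least_unique)
  qed (use that carrier in auto)
  have meet: "\<phi> x \<sqinter>\<^bsub>L\<^esub> \<phi> y = \<phi> (Lattices.inf x y)" if "x \<in> H" "y \<in> H" for x y
  proof (rule meetI)
    show "l = \<phi> (Lattices.inf x y)" if "is_glb L l {\<phi> x, \<phi> y}" for l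
      using that glb[OF \<open>x \<in> H\<close> \<open>y \<in> H\<close>] by (rule greatest_unique)
  qed (use that carrier in auto)
  show ?thesis
    by unfold_locales
      (auto simp: carrier join meet inf_closed sup_closed inf_sup_distrib1)
qed

section \<open>Orientations and height functions\<close>

lemma orientation_edge: "orientation G \<Omega> \<Longrightarrow> (u, v) \<in> \<Omega> \<Longrightarrow> (u, v) \<in> parcs G"
  unfolding orientation_def by blast

lemma orientation_antisym: "orientation G \<Omega> \<Longrightarrow> (u, v) \<in> \<Omega> \<Longrightarrow> (v, u) \<notin> \<Omega>"
  unfolding orientation_def by blast

lemma orientation_total: "orientation G \<Omega> \<Longrightarrow> (u, v) \<in> parcs G \<Longrightarrow> (u, v) \<in> \<Omega> \<or> (v, u) \<in> \<Omega>"
  unfolding orientation_def by blast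

text \<open>The value 0 off the vertices is a default that makes equality of functions mean equality
  of heights. Height 0 at the neighbours of \<open>s\<close> keeps their arcs directed towards
  \<open>s\<close>.\<close>

definition heights :: "'v pair_pre_digraph \<Rightarrow> 'v \<Rightarrow> 'v rel \<Rightarrow> ('v \<Rightarrow> int) set" where
  "heights G s \<Omega> = {f. (\<forall>v. v \<notin> pverts G \<longrightarrow> f v = 0) \<and> f s = 0 \<and>
     (\<forall>u. (u, s) \<in> parcs G \<longrightarrow> f u = 0) \<and>
     (\<forall>u v. (u, v) \<in> \<Omega> \<longrightarrow> f u = f v \<or> f u = f v + 1)}"

definition tilt :: "'v rel \<Rightarrow> ('v \<Rightarrow> int) \<Rightarrow> 'v rel" where
  "tilt \<Omega> f = {(u, v). (u, v) \<in> \<Omega> \<and> f u = f v \<or> (v, u) \<in> \<Omega> \<and> f u \<noteq> f v}"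

lemma tilt_iff: "(u, v) \<in> tilt \<Omega> f \<longleftrightarrow> (u, v) \<in> \<Omega> \<and> f u = f v \<or> (v, u) \<in> \<Omega> \<and> f u \<noteq> f v"
  by (simp add: tilt_def)

lemma heights_arc: "f \<in> heights G s \<Omega> \<Longrightarrow> (u, v) \<in> \<Omega> \<Longrightarrow> f u = f v \<or> f u = f v + 1"
  by (simp add: heights_def)

text \<open>On integers the arc condition reads \<open>f v \<le> f u \<le> f v + 1\<close>. Such
  difference bounds survive pointwise minimum and maximum.\<close>

lemma heights_closed:
  assumes "f \<in> heights G s \<Omega>" "g \<in> heights G s \<Omega>"
  shows "Lattices.inf f g \<in> heights G s \<Omega>" "Lattices.sup f g \<in> heights G s \<Omega>"
proof -
  have "min (f u) (g u) = min (f v) (g v) \<or> min (f u) (g u) = min (f v) (g v) + 1"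
    "max (f u) (g u) = max (f v) (g v) \<or> max (f u) (g u) = max (f v) (g v) + 1"
    if "(u, v) \<in> \<Omega>" for u v
    using heights_arc[OF assms(1) that] heights_arc[OF assms(2) that] by linarith+
  then show "Lattices.inf f g \<in> heights G s \<Omega>" "Lattices.sup f g \<in> heights G s \<Omega>"
    using assms by (simp_all add: heights_def inf_int_def sup_int_def)
qed

text \<open>Along a cycle of \<open>R\<close> the weakly increasing \<open>f\<close> must be
  constant, so the whole cycle would already lie in \<open>r\<close>.\<close>

lemma acyclic_restrict_level:
  assumes "acyclic r" and mono: "\<And>u v. (u, v) \<in> R \<Longrightarrow> f u \<le> (f v :: 'b::order)"
    and level: "\<And>u v. (u, v) \<in> R \<Longrightarrow> f u = f v \<Longrightarrow> (u, v) \<in> r"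
  shows "acyclic R"
proof -
  have "f u \<le> f v \<and> (f u = f v \<longrightarrow> (u, v) \<in> r\<^sup>+)" if "(u, v) \<in> R\<^sup>+" for u v
    using that
  proof induction
    case (base v)
    then show ?case using mono level by blast
  next
    case (step v w)
    then show ?case
      using mono[of v w] level[of v w] by (metis antisym order_trans trancl_into_trancl)
  qed
  then show ?thesis using \<open>acyclic r\<close> unfolding acyclic_def by blast
qed

section \<open>Orientations described by heights over a base orientation\<close>

locale sink_orientation = pair_graph G for G :: "'v pair_pre_digraph" +
  fixes s :: 'v and \<Omega> :: "'v rel"
  assumes base: "\<Omega> \<in> sink_orientations G s"
begin

lemma edge_sym: "(u, v) \<in> parcs G \<Longrightarrow> (v, u) \<in> parcs G"
  using pair_sym_arcs by (auto simp: symmetric_def elim: symE)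

lemma no_loop: "(u, u) \<notin> parcs G"
  using pair_no_loops by fastforce

lemma base_orientation: "orientation G \<Omega>"
  using base by (simp add: sink_orientations_def)

lemmas arc_edge = orientation_edge[OF base_orientation]
  and arc_antisym = orientation_antisym[OF base_orientation]

lemma edge_arc_cases:
  assumes "(u, v) \<in> parcs G"
  obtains "(u, v) \<in> \<Omega>" "(v, u) \<notin> \<Omega>" | "(v, u) \<in> \<Omega>" "(u, v) \<notin> \<Omega>"
  using orientation_total[OF base_orientation assms] arc_antisym by blast

lemma sink_arc: "(u, s) \<in> parcs G \<Longrightarrow> (u, s) \<in> \<Omega>"
  using base by (auto simp: sink_orientations_def sink_def)

lemma sink_vertex: "s \<in> pverts G"
  using base by (auto simp: sink_orientations_def sink_def)

lemma zero_in_heights: "(\<lambda>_. 0) \<in> heights G s \<Omega>"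
  by (simp add: heights_def)

lemma tilt_zero: "tilt \<Omega> (\<lambda>_. 0) = \<Omega>"
  by (simp add: tilt_def)

lemma tilt_subset: "tilt \<Omega> f \<subseteq> parcs G"
  using arc_edge edge_sym by (auto simp: tilt_iff)

text \<open>Heights stay equal along a kept arc and rise by 1 along a reversed one. A cycle would
  thus consist of kept arcs only and be a cycle of \<open>\<Omega>\<close>.\<close>

lemma tilt_in_sink_orientations:
  assumes f: "f \<in> heights G s \<Omega>"
  shows "tilt \<Omega> f \<in> sink_orientations G s"
proof -
  have "orientation G (tilt \<Omega> f)"
    unfolding orientation_def
  proof (intro conjI subrelI ballI case_prodI2)
    show "(u, v) \<in> parcs G" if "(u, v) \<in> tilt \<Omega> f" for u v
      using that tilt_subset by blast
    show "(u, v) \<in> tilt \<Omega> f \<longleftrightarrow> (v, u) \<notin> tilt \<Omega> f" if "e \<in> parcs G" "e = (u, v)" for e u v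
      using that(1) unfolding that(2) by (cases rule: edge_arc_cases) (auto simp: tilt_iff)
  qed
  moreover have "acyclic (tilt \<Omega> f)"
  proof (rule acyclic_restrict_level)
    show "acyclic \<Omega>" using base by (simp add: sink_orientations_def)
    show "f u \<le> f v" if "(u, v) \<in> tilt \<Omega> f" for u v
      using that heights_arc[OF f, of u v] heights_arc[OF f, of v u] by (auto simp: tilt_iff)
  qed (auto simp: tilt_iff)
  moreover have "sink G (tilt \<Omega> f) s"
    using f sink_vertex sink_arc by (auto simp: sink_def tilt_iff heights_def)
  ultimately show ?thesis by (simp add: sink_orientations_def)
qed

section \<open>Firing and unfiring a vertex in terms of heights\<close>

text \<open>Firing the sink itself is only possible when it is isolated, and then changes nothing.\<close>

lemma fire_sink:
  assumes "\<Omega>' \<in> sink_orientations G s" "source G \<Omega>' s"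
  shows "fire G s \<Omega>' = \<Omega>'"
proof -
  have or: "orientation G \<Omega>'" and "sink G \<Omega>' s"
    using assms by (auto simp: sink_orientations_def)
  have isolated: "(v, s) \<notin> parcs G" for v
  proof
    assume v: "(v, s) \<in> parcs G"
    then have "(v, s) \<in> \<Omega>'" using \<open>sink G \<Omega>' s\<close> by (simp add: sink_def)
    moreover have "(s, v) \<in> \<Omega>'" using assms(2) edge_sym[OF v] by (simp add: source_def)
    ultimately show False using orientation_antisym[OF or] by blast
  qed
  then have "u \<noteq> s \<and> v \<noteq> s" if "(u, v) \<in> \<Omega>'" for u v
    using orientation_edge[OF or that] edge_sym by blast
  with isolated show ?thesis by (auto simp: fire_def)
qed

text \<open>At a source \<open>i\<close> the arcs of \<open>\<Omega>\<close> leaving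
  \<open>i\<close> are kept and those entering it are reversed. Adding 1 to \<open>f i\<close>
  toggles each of them within the permitted differences, and \<open>nonadj\<close> protects the
  zeros next to \<open>s\<close>.\<close>

lemma fire_tilt:
  assumes f: "f \<in> heights G s \<Omega>" and "i \<noteq> s" and i: "source G (tilt \<Omega> f) i"
    and nonadj: "(i, s) \<notin> parcs G"
  shows "f(i := f i + 1) \<in> heights G s \<Omega>" "fire G i (tilt \<Omega> f) = tilt \<Omega> (f(i := f i + 1))"
proof -
  have out: "f i = f v" if "(i, v) \<in> \<Omega>" for v
    using i arc_edge[OF that] arc_antisym[OF that] by (auto simp: source_def tilt_iff)
  have "in": "f v = f i + 1" if "(v, i) \<in> \<Omega>" for v
    using i edge_sym[OF arc_edge[OF that]] arc_antisym[OF that] heights_arc[OF f that]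
    by (auto simp: source_def tilt_iff)
  have "(f(i := f i + 1)) u = (f(i := f i + 1)) v \<or> (f(i := f i + 1)) u = (f(i := f i + 1)) v + 1"
    if arc: "(u, v) \<in> \<Omega>" for u v
  proof -
    consider "u = i" "v \<noteq> i" | "u \<noteq> i" "v = i" | "u \<noteq> i" "v \<noteq> i"
      using arc_edge[OF arc] no_loop by blast
    then show ?thesis
    proof cases
      case 1
      then show ?thesis using out[of v] that by simp
    next
      case 2
      then show ?thesis using "in"[of u] that by simp
    next
      case 3
      then show ?thesis using heights_arc[OF f that] by simp
    qed
  qed
  then show "f(i := f i + 1) \<in> heights G s \<Omega>"
    using f \<open>i \<noteq> s\<close> i nonadj by (auto simp: heights_def source_def)
  have "(u, v) \<in> fire G i (tilt \<Omega> f) \<longleftrightarrow> (u, v) \<in> tilt \<Omega> (f(i := f i + 1))"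
    if edge: "(u, v) \<in> parcs G" for u v
  proof -
    consider "u = i" "v \<noteq> i" | "u \<noteq> i" "v = i" | "u \<noteq> i" "v \<noteq> i" using edge no_loop by blast
    then show ?thesis
    proof cases
      case 1
      with that show ?thesis using out[of v] "in"[of v]
        by (cases rule: edge_arc_cases) (auto simp: fire_def tilt_iff)
    next
      case 2
      with that show ?thesis using edge out[of u] "in"[of u]
        by (cases rule: edge_arc_cases) (auto simp: fire_def tilt_iff)
    next
      case 3
      then show ?thesis by (simp add: fire_def tilt_iff)
    qed
  qed
  moreover have "fire G i (tilt \<Omega> f) \<subseteq> parcs G"
    using tilt_subset by (auto simp: fire_def)
  ultimately show "fire G i (tilt \<Omega> f) = tilt \<Omega> (f(i := f i + 1))"
    using tilt_subset by (auto simp: subset_iff)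
qed

text \<open>Components are linked by firings read in both directions, so heights must also survive a
  backward step. After the firing \<open>i\<close> is a sink of \<open>tilt \<Omega> f\<close>: arcs
  of \<open>\<Omega>\<close> leaving \<open>i\<close> are reversed, those entering it are kept, and
  subtracting 1 from \<open>f i\<close> toggles both kinds.\<close>

lemma unfire_tilt:
  assumes f: "f \<in> heights G s \<Omega>" and "i \<noteq> s" and \<Omega>': "\<Omega>' \<in> sink_orientations G s"
    and i: "source G \<Omega>' i" and fire: "fire G i \<Omega>' = tilt \<Omega> f"
  shows "f(i := f i - 1) \<in> heights G s \<Omega>" "\<Omega>' = tilt \<Omega> (f(i := f i - 1))"
proof -
  have into: "(u, i) \<in> tilt \<Omega> f" if "(u, i) \<in> parcs G" for u
    using that by (auto simp: fire[symmetric] fire_def)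
  have out: "f i = f v + 1" if "(i, v) \<in> \<Omega>" for v
    using into[OF edge_sym[OF arc_edge[OF that]]] arc_antisym[OF that] heights_arc[OF f that]
    by (auto simp: tilt_iff)
  have "in": "f v = f i" if "(v, i) \<in> \<Omega>" for v
    using into[OF arc_edge[OF that]] arc_antisym[OF that] by (auto simp: tilt_iff)
  \<comment> \<open>For a neighbour \<open>i\<close> of \<open>s\<close>, \<open>out\<close> would
    give \<open>f i = f s + 1 = 1\<close>, but heights vanish next to \<open>s\<close>.\<close>
  have nonadj: "(i, s) \<notin> parcs G"
    using out sink_arc f by (fastforce simp: heights_def)
  have "(f(i := f i - 1)) u = (f(i := f i - 1)) v \<or> (f(i := f i - 1)) u = (f(i := f i - 1)) v + 1"
    if arc: "(u, v) \<in> \<Omega>" for u v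
  proof -
    consider "u = i" "v \<noteq> i" | "u \<noteq> i" "v = i" | "u \<noteq> i" "v \<noteq> i"
      using arc_edge[OF arc] no_loop by blast
    then show ?thesis
    proof cases
      case 1
      then show ?thesis using out[of v] that by simp
    next
      case 2
      then show ?thesis using "in"[of u] that by simp
    next
      case 3
      then show ?thesis using heights_arc[OF f that] by simp
    qed
  qed
  then show "f(i := f i - 1) \<in> heights G s \<Omega>"
    using f \<open>i \<noteq> s\<close> i nonadj by (auto simp: heights_def source_def)
  have or: "orientation G \<Omega>'" using \<Omega>' by (simp add: sink_orientations_def)
  have "(u, v) \<in> \<Omega>' \<longleftrightarrow> (u, v) \<in> tilt \<Omega> (f(i := f i - 1))" if edge: "(u, v) \<in> parcs G" for u v
  proof -
    consider "u = i" "v \<noteq> i" | "u \<noteq> i" "v = i" | "u \<noteq> i" "v \<noteq> i" using edge no_loop by blast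
    then show ?thesis
    proof cases
      case 1
      then have "(u, v) \<in> \<Omega>'" using that i by (simp add: source_def)
      with that show ?thesis using 1 out[of v] "in"[of v]
        by (cases rule: edge_arc_cases) (auto simp: tilt_iff)
    next
      case 2
      then have "(v, u) \<in> \<Omega>'" using that i edge_sym by (simp add: source_def)
      then have "(u, v) \<notin> \<Omega>'" by (rule orientation_antisym[OF or])
      with that show ?thesis using 2 out[of u] "in"[of u]
        by (cases rule: edge_arc_cases) (auto simp: tilt_iff)
    next
      case 3
      then have "(u, v) \<in> \<Omega>' \<longleftrightarrow> (u, v) \<in> tilt \<Omega> f" by (auto simp: fire[symmetric] fire_def)
      then show ?thesis using 3 by (simp add: tilt_iff)
    qed
  qed
  moreover have "\<Omega>' \<subseteq> parcs G" using or by (simp add: orientation_def)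
  ultimately show "\<Omega>' = tilt \<Omega> (f(i := f i - 1))" using tilt_subset by (auto simp: subset_iff)
qed

lemma firing_step_from_tilt:
  assumes f: "f \<in> heights G s \<Omega>" and step: "(tilt \<Omega> f, \<Omega>') \<in> firing_step G s"
  shows "\<exists>g \<in> heights G s \<Omega>. f \<le> g \<and> \<Omega>' = tilt \<Omega> g"
proof -
  obtain i where i: "source G (tilt \<Omega> f) i" and \<Omega>': "\<Omega>' = fire G i (tilt \<Omega> f)"
    and sink: "\<Omega>' \<in> sink_orientations G s" and "tilt \<Omega> f \<in> sink_orientations G s"
    using step by (auto simp: firing_step_def)
  show ?thesis
  proof (cases "i = s")
    case True
    then show ?thesis using f i \<Omega>' fire_sink \<open>tilt \<Omega> f \<in> _\<close> by auto
  next
    case False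
    \<comment> \<open>Firing a neighbour of \<open>s\<close> would direct their common edge away
      from \<open>s\<close>, which has to remain a sink.\<close>
    have "(i, s) \<notin> parcs G"
    proof
      assume "(i, s) \<in> parcs G"
      then have "(i, s) \<in> fire G i (tilt \<Omega> f)"
        using sink \<Omega>' by (auto simp: sink_orientations_def sink_def)
      then show False using False by (auto simp: fire_def)
    qed
    note fire_tilt[OF f False i this]
    then show ?thesis using \<Omega>' by (intro bexI[of _ "f(i := f i + 1)"]) (auto simp: le_fun_def)
  qed
qed

lemma firing_step_to_tilt:
  assumes f: "f \<in> heights G s \<Omega>" and step: "(\<Omega>', tilt \<Omega> f) \<in> firing_step G s"
  shows "\<exists>g \<in> heights G s \<Omega>. \<Omega>' = tilt \<Omega> g"
proof -
  obtain i where i: "source G \<Omega>' i" and fire: "fire G i \<Omega>' = tilt \<Omega> f"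
    and sink: "\<Omega>' \<in> sink_orientations G s"
    using step by (auto simp: firing_step_def)
  show ?thesis
  proof (cases "i = s")
    case True
    then show ?thesis using f i fire sink fire_sink by auto
  next
    case False
    then show ?thesis using unfire_tilt[OF f False sink i fire] by blast
  qed
qed

section \<open>Firing sequences and the pointwise order\<close>

lemma firing_from_tilt:
  assumes "(tilt \<Omega> f, \<Omega>') \<in> (firing_step G s)\<^sup>*" "f \<in> heights G s \<Omega>"
  shows "\<exists>g \<in> heights G s \<Omega>. f \<le> g \<and> \<Omega>' = tilt \<Omega> g"
  using assms
proof induction
  case (step \<Omega>1 \<Omega>2)
  then show ?case by (metis firing_step_from_tilt order_trans)
qed auto

lemma firing_to_tilt:
  assumes "(\<Omega>', tilt \<Omega> f) \<in> (firing_step G s)\<^sup>*" "f \<in> heights G s \<Omega>"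
  shows "\<exists>g \<in> heights G s \<Omega>. \<Omega>' = tilt \<Omega> g"
  using assms by (induction rule: converse_rtrancl_induct) (auto dest: firing_step_to_tilt)

lemma ex_source_below:
  assumes f: "f \<in> heights G s \<Omega>" and g: "g \<in> heights G s \<Omega>" and "f \<le> g" "f \<noteq> g"
  shows "\<exists>i. f i < g i \<and> source G (tilt \<Omega> f) i"
proof -
  define D where "D = {v. f v < g v}"
  have D: "v \<in> pverts G" if "v \<in> D" for v
    using f g that by (cases "v \<in> pverts G") (auto simp: D_def heights_def)
  have "D \<noteq> {}" using \<open>f \<le> g\<close> \<open>f \<noteq> g\<close> by (auto simp: D_def le_fun_def fun_eq_iff order_less_le)
  have or: "orientation G (tilt \<Omega> f)" "acyclic (tilt \<Omega> f)"
    using tilt_in_sink_orientations[OF f] by (auto simp: sink_orientations_def)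
  then have "finite (tilt \<Omega> f)"
    using pair_finite_arcs by (auto simp: orientation_def intro: finite_subset)
  then have "wf (tilt \<Omega> f)" using or by (simp add: finite_acyclic_wf)
  then obtain i where i: "i \<in> D" "\<And>u. (u, i) \<in> tilt \<Omega> f \<Longrightarrow> u \<notin> D"
    using \<open>D \<noteq> {}\<close> by (metis wfE_min')
  have "(u, i) \<notin> tilt \<Omega> f" for u
  proof
    assume u: "(u, i) \<in> tilt \<Omega> f"
    then have "g u = f u" using i(2)[of u] \<open>f \<le> g\<close> by (auto simp: D_def le_fun_def intro: antisym)
    moreover have "f i < g i" using i(1) by (simp add: D_def)
    \<comment> \<open>Given \<open>f u\<close>, the arc \<open>(u, i)\<close> of the tilt means that
      \<open>f i\<close> is already the largest value allowed at \<open>i\<close>: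
      \<open>f u\<close> if the arc is kept, \<open>f u + 1\<close> if it is reversed. Since
      \<open>g u = f u\<close>, the same bound holds for \<open>g i\<close>, against
      \<open>f i < g i\<close>.\<close>
    ultimately show False
      using u heights_arc[OF f, of u i] heights_arc[OF g, of u i]
        heights_arc[OF f, of i u] heights_arc[OF g, of i u] by (auto simp: tilt_iff)
  qed
  then have "(i, v) \<in> tilt \<Omega> f" if "(i, v) \<in> parcs G" for v
    using orientation_total[OF or(1) that] by blast
  then show ?thesis using i(1) D by (auto simp: source_def D_def)
qed

text \<open>Induction on the total gap between \<open>f\<close> and \<open>g\<close>: firing a
  source where \<open>f\<close> is below \<open>g\<close> raises \<open>f\<close> there by 1 and
  keeps it below \<open>g\<close>.\<close>

lemma tilt_mono:
  assumes "f \<in> heights G s \<Omega>" "g \<in> heights G s \<Omega>" "f \<le> g"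
  shows "(tilt \<Omega> f, tilt \<Omega> g) \<in> (firing_step G s)\<^sup>*"
  using assms
proof (induction "nat (\<Sum>v\<in>pverts G. g v - f v)" arbitrary: f rule: less_induct)
  case less
  show ?case
  proof (cases "f = g")
    case False
    obtain i where i: "f i < g i" "source G (tilt \<Omega> f) i"
      using ex_source_below[OF less.prems False] by blast
    let ?f = "f(i := f i + 1)"
    \<comment> \<open>Both \<open>f\<close> and \<open>g\<close> vanish at \<open>s\<close> and its
      neighbours, so \<open>f i < g i\<close> excludes these vertices.\<close>
    have "i \<noteq> s" "(i, s) \<notin> parcs G" using i(1) less.prems(1,2) by (auto simp: heights_def)
    note fire = fire_tilt[OF less.prems(1) this(1) i(2) this(2)]
    have "i \<in> pverts G" using i by (simp add: source_def)
    then have "(\<Sum>v\<in>pverts G. g v - ?f v) < (\<Sum>v\<in>pverts G. g v - f v)"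
      using pair_finite_verts by (intro sum_strict_mono_ex1) auto
    moreover have le: "?f \<le> g" using i(1) less.prems(3) by (auto simp: le_fun_def)
    \<comment> \<open>Without a nonnegative new gap the strict decrease could be lost under
      \<open>nat\<close>.\<close>
    moreover have "0 \<le> (\<Sum>v\<in>pverts G. g v - ?f v)"
      using le by (intro sum_nonneg) (auto simp: le_fun_def)
    ultimately have "(tilt \<Omega> ?f, tilt \<Omega> g) \<in> (firing_step G s)\<^sup>*"
      using less.hyps[OF _ fire(1) less.prems(2)] by simp
    moreover have "(tilt \<Omega> f, tilt \<Omega> ?f) \<in> firing_step G s"
      using i(2) fire tilt_in_sink_orientations less.prems(1)
      by (auto simp: firing_step_def)
    ultimately show ?thesis by (rule converse_rtrancl_into_rtrancl[rotated])
  qed simp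
qed

text \<open>The direction of an edge determines the height difference of its ends, so
  \<open>f - g\<close> is constant along edges. Connectedness spreads its value 0 at
  \<open>s\<close> to all vertices.\<close>

lemma tilt_inj:
  assumes "Digraph_Component.connected (with_proj G)"
    and f: "f \<in> heights G s \<Omega>" and g: "g \<in> heights G s \<Omega>" and eq: "tilt \<Omega> f = tilt \<Omega> g"
  shows "f = g"
proof
  fix v
  have arc: "f u - g u = f v - g v" if "(u, v) \<in> \<Omega>" for u v
  proof -
    have "f u = f v \<longleftrightarrow> g u = g v"
      using eq that arc_antisym[OF that] by (metis tilt_iff)
    then show ?thesis using heights_arc[OF f that] heights_arc[OF g that] by linarith
  qed
  show "f v = g v"
  proof (cases "v \<in> pverts G")
    case True
    \<comment> \<open>\<open>connected\<close> refers to the symmetric closure, which has the same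
      reachability as the symmetric digraph \<open>G\<close>.\<close>
    then have "s \<rightarrow>\<^sup>*\<^bsub>with_proj G\<^esub> v"
      using assms(1) sink_vertex reachable_mk_symmetric_eq pair_sym_arcs
      by (auto simp: connected_def strongly_connected_def)
    then have "f v - g v = 0"
    proof (induction rule: reachable_induct)
      case base
      then show ?case using f g by (simp add: heights_def)
    next
      case (step x y)
      then have "(x, y) \<in> parcs G" by simp
      then show ?case using arc[of x y] arc[of y x] step.IH by (cases rule: edge_arc_cases) auto
    qed
    then show ?thesis by simp
  next
    case False
    then show ?thesis using f g by (simp add: heights_def)
  qed
qed

text \<open>A firing sequence from \<open>tilt \<Omega> f\<close> ends at the tilt of some height
  function above \<open>f\<close>, which \<open>tilt_inj\<close> identifies with \<open>g\<close>.
  The converse is \<open>tilt_mono\<close>.\<close>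

lemma tilt_le_iff:
  assumes "Digraph_Component.connected (with_proj G)"
    and f: "f \<in> heights G s \<Omega>" and g: "g \<in> heights G s \<Omega>"
  shows "(tilt \<Omega> f, tilt \<Omega> g) \<in> (firing_step G s)\<^sup>* \<longleftrightarrow> f \<le> g"
  using firing_from_tilt[OF _ f] tilt_inj[OF assms(1) g] tilt_mono[OF f g] by metis

section \<open>Components as images of the height functions\<close>

lemma component_eq_tilt_image:
  assumes C: "C \<in> pre_digraph.sccs_verts (with_proj (comparability_graph (firing_poset G s)))"
    and "\<Omega> \<in> C"
  shows "C = tilt \<Omega> ` heights G s \<Omega>"
proof -
  let ?K = "comparability_graph (firing_poset G s)"
  interpret K: pair_wf_digraph ?K
    by unfold_locales (auto simp: comparability_graph_def)
  have sccs: "x \<rightarrow>\<^sup>*\<^bsub>with_proj ?K\<^esub> y" if "x \<in> C" "y \<in> C" for x y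
    using C that by (auto simp: pre_digraph.sccs_verts_def)
  \<comment> \<open>Components are encoded as strong ones, so absorbing a vertex takes paths both
    ways.\<close>
  have max: "y \<in> C" if "x \<in> C" "x \<rightarrow>\<^sup>*\<^bsub>with_proj ?K\<^esub> y" "y \<rightarrow>\<^sup>*\<^bsub>with_proj ?K\<^esub> x" for x y
    using C that unfolding pre_digraph.sccs_verts_def by blast
  have comparable: "tilt \<Omega> f \<rightarrow>\<^sup>*\<^bsub>with_proj ?K\<^esub> tilt \<Omega> g"
    if "f \<in> heights G s \<Omega>" "g \<in> heights G s \<Omega>" "f \<le> g \<or> g \<le> f" for f g
  proof -
    have "tilt \<Omega> f \<in> pverts ?K" "tilt \<Omega> g \<in> pverts ?K"
      using that tilt_in_sink_orientations by (auto simp: comparability_graph_def firing_poset_def)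
    moreover have "(tilt \<Omega> f, tilt \<Omega> g) \<in> parcs ?K" if "tilt \<Omega> f \<noteq> tilt \<Omega> g"
      using that \<open>f \<in> _\<close> \<open>g \<in> _\<close> \<open>f \<le> g \<or> g \<le> f\<close> tilt_mono tilt_in_sink_orientations
      by (auto simp: comparability_graph_def firing_poset_def)
    ultimately show ?thesis by (cases "tilt \<Omega> f = tilt \<Omega> g") auto
  qed
  show ?thesis
  proof
    show "C \<subseteq> tilt \<Omega> ` heights G s \<Omega>"
    proof
      fix x assume "x \<in> C"
      \<comment> \<open>Each edge of a comparability path is a firing sequence up or down, and
        neither direction leaves the image.\<close>
      with \<open>\<Omega> \<in> C\<close> have "\<Omega> \<rightarrow>\<^sup>*\<^bsub>with_proj ?K\<^esub> x" by (rule sccs)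
      then show "x \<in> tilt \<Omega> ` heights G s \<Omega>"
      proof (induction rule: K.reachable_induct)
        case base
        then show ?case using zero_in_heights tilt_zero by (metis imageI)
      next
        case (step x y)
        then have "(x, y) \<in> (firing_step G s)\<^sup>* \<or> (y, x) \<in> (firing_step G s)\<^sup>*"
          by (auto simp: comparability_graph_def firing_poset_def)
        then show ?case using step.IH firing_from_tilt firing_to_tilt by blast
      qed
    qed
  next
    show "tilt \<Omega> ` heights G s \<Omega> \<subseteq> C"
    proof
      fix x assume "x \<in> tilt \<Omega> ` heights G s \<Omega>"
      then obtain f where f: "f \<in> heights G s \<Omega>" and x: "x = tilt \<Omega> f" by blast
      \<comment> \<open>\<open>\<Omega>\<close> is the tilt of the zero function, so
        \<open>tilt \<Omega> ?m\<close> is a common lower bound of \<open>\<Omega>\<close> and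
        \<open>x\<close> and joins them by a path.\<close>
      let ?m = "Lattices.inf (\<lambda>_. 0) f"
      have m: "?m \<in> heights G s \<Omega>" using heights_closed(1)[OF zero_in_heights f] .
      have "\<Omega> \<rightarrow>\<^sup>*\<^bsub>with_proj ?K\<^esub> tilt \<Omega> ?m" "tilt \<Omega> ?m \<rightarrow>\<^sup>*\<^bsub>with_proj ?K\<^esub> \<Omega>"
        using comparable[OF zero_in_heights m] comparable[OF m zero_in_heights]
        by (simp_all add: tilt_zero)
      moreover have "x \<rightarrow>\<^sup>*\<^bsub>with_proj ?K\<^esub> tilt \<Omega> ?m" "tilt \<Omega> ?m \<rightarrow>\<^sup>*\<^bsub>with_proj ?K\<^esub> x"
        using comparable[OF f m] comparable[OF m f] x by simp_all
      ultimately show "x \<in> C" using max[OF \<open>\<Omega> \<in> C\<close>] K.reachable_trans by blast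
    qed
  qed
qed

end

theorem theorem9:
  fixes n :: nat and G :: "nat pair_pre_digraph"
  assumes "pair_graph G"
    and "pverts G = {0..n}"
    and "Digraph_Component.connected (with_proj G)"
  shows "\<forall>C \<in> order_components (firing_poset G 0). distributive_lattice C"
proof
  let ?L = "firing_poset G 0"
  let ?K = "comparability_graph ?L"
  interpret K: pair_wf_digraph ?K
    by unfold_locales (auto simp: comparability_graph_def)
  fix L assume "L \<in> order_components ?L"
  then obtain C where L: "L = ?L\<lparr>carrier := C\<rparr>" and C: "C \<in> pre_digraph.sccs_verts (with_proj ?K)"
    by (auto simp: order_components_def)
  \<comment> \<open>Strong components are nonempty, and any member can serve as the base
    orientation.\<close>
  then obtain \<Omega> where "\<Omega> \<in> C" by (auto simp: pre_digraph.sccs_verts_def)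
  then have "\<Omega> \<in> sink_orientations G 0"
    using K.sccs_verts_subsets[OF C] by (auto simp: comparability_graph_def firing_poset_def)
  then interpret sink_orientation G 0 \<Omega>
    using assms(1) by (simp add: sink_orientation_def sink_orientation_axioms_def)
  show "distributive_lattice L"
  proof (rule distributive_lattice_image)
    show "carrier L = tilt \<Omega> ` heights G 0 \<Omega>"
      using component_eq_tilt_image[OF C \<open>\<Omega> \<in> C\<close>] by (simp add: L)
    show "tilt \<Omega> f \<sqsubseteq>\<^bsub>L\<^esub> tilt \<Omega> g \<longleftrightarrow> f \<le> g"
      if "f \<in> heights G 0 \<Omega>" "g \<in> heights G 0 \<Omega>" for f g
      using tilt_le_iff[OF assms(3) that] by (simp add: L firing_poset_def)
  qed (auto simp: L firing_poset_def heights_closed)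
qed

end
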